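(* Let $R$ be a commutative ring, $\mathcal A$ an associative $R$-algebra with center $Z(\mathcal A)$, and $(\mathcal A[[\nu]],\star)$ a formal deformation of $\mathcal A$. Let $\mathbf H=(H_0,\overline{H_1})\in\Pi(\mathcal A)=Z(\mathcal A)\times(\mathcal A/Z(\mathcal A))$ and define $\partial_{\mathbf H}:\mathcal A\to\mathcal A$ by $\partial_{\mathbf H}a:=\{\mathbf H;a\}=\{H_0,a\}_1+[H_1,a]$. Then $\partial_{\mathbf H}$ is a derivation of $\mathcal A$, i.e. an $R$-linear map satisfying $\partial_{\mathbf H}(ab)=a\,\partial_{\mathbf H}b+(\partial_{\mathbf H}a)\,b$ for all $a,b\in\mathcal A$.
   Context: Associative algebras are unital and not necessarily commutative; $[a,b]=ab-ba$ in $\mathcal A$. A formal deformation of $\mathcal A$ is an associative $R[[\nu]]$-algebra structure $\star$ on the $R[[\nu]]$-module $\mathcal A[[\nu]]$ of formal power series such that $a\star b-ab\in\nu\mathcal A[[\nu]]$ for all $a,b\in\mathcal A$. For $a,b\in\mathcal A$, the maps $\{\cdot,\cdot\}_i:\mathcal A\times\mathcal A\to\mathcal A$ are defined by $a\star b-b\star a=[a,b]+\nu\{a,b\}_1+\nu^2\{a,b\}_2+\cdots$. Here $\mathcal A/Z(\mathcal A)$ is the quotient of $R$-modules and $\overline{b}=b+Z(\mathcal A)$; the expression $\{H_0,a\}_1+[H_1,a]$ does not depend on the representative $H_1$ of $\overline{H_1}$. *)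

theory Defs
  imports "HOL-Algebra.AbelCoset" "HOL-Algebra.Module"
begin

text \<open>
  Unital associative algebras over a commutative ring. The locale \<open>algebra\<close> of HOL-Algebra
  requires the algebra itself to be commutative, so it cannot be used.
\<close>

locale assoc_algebra = module R A + ring A for R (structure) and A (structure) +
  assumes smult_mult_left:
      "\<lbrakk>r \<in> carrier R; a \<in> carrier A; b \<in> carrier A\<rbrakk> \<Longrightarrow>
       (r \<odot>\<^bsub>A\<^esub> a) \<otimes>\<^bsub>A\<^esub> b = r \<odot>\<^bsub>A\<^esub> (a \<otimes>\<^bsub>A\<^esub> b)"
    and smult_mult_right:
      "\<lbrakk>r \<in> carrier R; a \<in> carrier A; b \<in> carrier A\<rbrakk> \<Longrightarrow>
       a \<otimes>\<^bsub>A\<^esub> (r \<odot>\<^bsub>A\<^esub> b) = r \<odot>\<^bsub>A\<^esub> (a \<otimes>\<^bsub>A\<^esub> b)"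

definition commutator :: "('a, 'n) ring_scheme \<Rightarrow> 'a \<Rightarrow> 'a \<Rightarrow> 'a" where
  "commutator A a b = a \<otimes>\<^bsub>A\<^esub> b \<ominus>\<^bsub>A\<^esub> b \<otimes>\<^bsub>A\<^esub> a"

definition center :: "('a, 'n) ring_scheme \<Rightarrow> 'a set" where
  "center A = {z \<in> carrier A. \<forall>a \<in> carrier A. z \<otimes>\<^bsub>A\<^esub> a = a \<otimes>\<^bsub>A\<^esub> z}"

definition is_derivation ::
    "('r, 'm) ring_scheme \<Rightarrow> ('r, 'a, 'n) module_scheme \<Rightarrow> ('a \<Rightarrow> 'a) \<Rightarrow> bool" where
  "is_derivation R A D \<longleftrightarrow>
     D \<in> carrier A \<rightarrow> carrier A \<and>
     (\<forall>a \<in> carrier A. \<forall>b \<in> carrier A. D (a \<oplus>\<^bsub>A\<^esub> b) = D a \<oplus>\<^bsub>A\<^esub> D b) \<and>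
     (\<forall>r \<in> carrier R. \<forall>a \<in> carrier A. D (r \<odot>\<^bsub>A\<^esub> a) = r \<odot>\<^bsub>A\<^esub> D a) \<and>
     (\<forall>a \<in> carrier A. \<forall>b \<in> carrier A.
        D (a \<otimes>\<^bsub>A\<^esub> b) = a \<otimes>\<^bsub>A\<^esub> D b \<oplus>\<^bsub>A\<^esub> D a \<otimes>\<^bsub>A\<^esub> b)"

text \<open>
  A formal power series is the sequence of its coefficients. The following two structures are
  the ring \<open>R[[\<nu>]]\<close> and the \<open>R[[\<nu>]]\<close>-algebra \<open>A[[\<nu>]]\<close> with the undeformed (Cauchy) product.
\<close>

definition ps_ring :: "('r, 'm) ring_scheme \<Rightarrow> (nat \<Rightarrow> 'r) ring" where
  "ps_ring R =
     \<lparr>carrier = UNIV \<rightarrow> carrier R,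
      mult = (\<lambda>f g n. \<Oplus>\<^bsub>R\<^esub>i \<in> {..n}. f i \<otimes>\<^bsub>R\<^esub> g (n - i)),
      one = (\<lambda>n. if n = 0 then \<one>\<^bsub>R\<^esub> else \<zero>\<^bsub>R\<^esub>),
      zero = (\<lambda>n. \<zero>\<^bsub>R\<^esub>),
      add = (\<lambda>f g n. f n \<oplus>\<^bsub>R\<^esub> g n)\<rparr>"

definition ps_algebra :: "('r, 'a, 'n) module_scheme \<Rightarrow> (nat \<Rightarrow> 'r, nat \<Rightarrow> 'a) module" where
  "ps_algebra A =
     \<lparr>carrier = UNIV \<rightarrow> carrier A,
      mult = (\<lambda>x y n. \<Oplus>\<^bsub>A\<^esub>i \<in> {..n}. x i \<otimes>\<^bsub>A\<^esub> y (n - i)),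
      one = (\<lambda>n. if n = 0 then \<one>\<^bsub>A\<^esub> else \<zero>\<^bsub>A\<^esub>),
      zero = (\<lambda>n. \<zero>\<^bsub>A\<^esub>),
      add = (\<lambda>x y n. x n \<oplus>\<^bsub>A\<^esub> y n),
      smult = (\<lambda>f x n. \<Oplus>\<^bsub>A\<^esub>i \<in> {..n}. f i \<odot>\<^bsub>A\<^esub> x (n - i))\<rparr>"

definition ps_const :: "('a, 'n) ring_scheme \<Rightarrow> 'a \<Rightarrow> nat \<Rightarrow> 'a" where
  "ps_const A a = (\<lambda>n. if n = 0 then a else \<zero>\<^bsub>A\<^esub>)"

definition ps_var :: "('r, 'm) ring_scheme \<Rightarrow> nat \<Rightarrow> 'r" where
  "ps_var R = (\<lambda>n. if n = 1 then \<one>\<^bsub>R\<^esub> else \<zero>\<^bsub>R\<^esub>)"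

text \<open>
  The product and the unit of \<open>A[[\<nu>]]\<close> are replaced, while the \<open>R[[\<nu>]]\<close>-module structure is
  kept. The unit \<open>e\<close> of the deformed product is not required to be the unit of \<open>A\<close>.
\<close>

definition formal_deformation ::
    "('r, 'm) ring_scheme \<Rightarrow> ('r, 'a, 'n) module_scheme \<Rightarrow>
     ((nat \<Rightarrow> 'a) \<Rightarrow> (nat \<Rightarrow> 'a) \<Rightarrow> (nat \<Rightarrow> 'a)) \<Rightarrow> bool" where
  "formal_deformation R A star \<longleftrightarrow>
     (\<exists>e. assoc_algebra (ps_ring R) ((ps_algebra A)\<lparr>mult := star, one := e\<rparr>)) \<and>
     (\<forall>a \<in> carrier A. \<forall>b \<in> carrier A.
        star (ps_const A a) (ps_const A b) \<ominus>\<^bsub>ps_algebra A\<^esub> ps_const A (a \<otimes>\<^bsub>A\<^esub> b)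
          \<in> {ps_var R \<odot>\<^bsub>ps_algebra A\<^esub> x | x. x \<in> carrier (ps_algebra A)})"

definition deformation_bracket ::
    "('r, 'a, 'n) module_scheme \<Rightarrow> ((nat \<Rightarrow> 'a) \<Rightarrow> (nat \<Rightarrow> 'a) \<Rightarrow> (nat \<Rightarrow> 'a)) \<Rightarrow>
     nat \<Rightarrow> 'a \<Rightarrow> 'a \<Rightarrow> 'a" where
  "deformation_bracket A star i a b =
     (star (ps_const A a) (ps_const A b)
        \<ominus>\<^bsub>ps_algebra A\<^esub> star (ps_const A b) (ps_const A a)) i"

text \<open>\<open>\<Pi>(A) = Z(A) \<times> (A/Z(A))\<close>, the second factor being the set of additive cosets of \<open>Z(A)\<close>.\<close>

definition Pi_space :: "('a, 'n) ring_scheme \<Rightarrow> ('a \<times> 'a set) set" where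
  "Pi_space A = center A \<times> (a_rcosets\<^bsub>A\<^esub> (center A))"

text \<open>
  The bracket \<open>{H; a}\<close> for \<open>H\<close> in \<open>\<Pi>(A)\<close>, computed with some representative of the
  second component; the lemma \<open>Pi_bracket_rep\<close> below shows that the choice is immaterial.
\<close>

definition Pi_bracket ::
    "('r, 'a, 'n) module_scheme \<Rightarrow> ((nat \<Rightarrow> 'a) \<Rightarrow> (nat \<Rightarrow> 'a) \<Rightarrow> (nat \<Rightarrow> 'a)) \<Rightarrow>
     'a \<times> 'a set \<Rightarrow> 'a \<Rightarrow> 'a" where
  "Pi_bracket A star H a =
     deformation_bracket A star 1 (fst H) a \<oplus>\<^bsub>A\<^esub> commutator A (SOME h. h \<in> snd H) a"

lemma (in ring) commutator_add_center:
  assumes z: "z \<in> center R" and h: "h \<in> carrier R" and a: "a \<in> carrier R"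
  shows "commutator R (z \<oplus> h) a = commutator R h a"
proof -
  have zc: "z \<in> carrier R" and za: "z \<otimes> a = a \<otimes> z"
    using z a by (auto simp: center_def)
  have "commutator R (z \<oplus> h) a = (a \<otimes> z \<oplus> h \<otimes> a) \<ominus> (a \<otimes> z \<oplus> a \<otimes> h)"
    using zc h a za by (simp add: commutator_def l_distr r_distr)
  also have "\<dots> = commutator R h a"
    unfolding commutator_def using zc h a by algebra
  finally show ?thesis .
qed

lemma Pi_bracket_rep:
  assumes "ring A" and "h \<in> carrier A" and "a \<in> carrier A"
  shows "Pi_bracket A star (H0, center A +>\<^bsub>A\<^esub> h) a =
         deformation_bracket A star 1 H0 a \<oplus>\<^bsub>A\<^esub> commutator A h a"
proof -
  interpret ring A by fact
  have "\<zero>\<^bsub>A\<^esub> \<in> center A"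
    by (simp add: center_def)
  then have "\<zero>\<^bsub>A\<^esub> \<oplus>\<^bsub>A\<^esub> h \<in> center A +>\<^bsub>A\<^esub> h"
    unfolding a_r_coset_def' by blast
  then have "(SOME h'. h' \<in> center A +>\<^bsub>A\<^esub> h) \<in> center A +>\<^bsub>A\<^esub> h"
    by (rule someI)
  then obtain z where "z \<in> center A" "(SOME h'. h' \<in> center A +>\<^bsub>A\<^esub> h) = z \<oplus>\<^bsub>A\<^esub> h"
    unfolding a_r_coset_def' by blast
  then show ?thesis
    using assms by (simp add: Pi_bracket_def commutator_add_center)
qed

end

theory Submission
  imports Defs
begin

text \<open>
  Write \<open>a \<star> b = ab + \<nu> m(a, b) + \<dots>\<close> for \<open>a, b\<close> in \<open>A\<close>. Since the product is bilinear over
  \<open>R[[\<nu>]]\<close>, the coefficients of orders \<open>0\<close> and \<open>1\<close> of \<open>x \<star> y\<close> depend only on those of \<open>x\<close> and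
  \<open>y\<close>, and the order \<open>1\<close> part of associativity says that \<open>m\<close> is a Hochschild 2-cocycle. For a
  central element \<open>h\<close>, the alternating sum of the cocycle identities at \<open>(h, a, b)\<close>, \<open>(a, h, b)\<close>
  and \<open>(a, b, h)\<close> is the Leibniz rule for \<open>{h, a}\<^sub>1 = m(h, a) - m(a, h)\<close>. The remaining summand
  of the bracket is an inner derivation.
\<close>

section \<open>Coefficients in the module of formal power series\<close>

lemma carrier_ps_ring: "carrier (ps_ring R) = UNIV \<rightarrow> carrier R"
  by (simp add: ps_ring_def)

lemma ps_algebra_sel:
  shows carrier_ps_algebra: "carrier (ps_algebra A) = UNIV \<rightarrow> carrier A"
    and zero_ps_algebra: "\<zero>\<^bsub>ps_algebra A\<^esub> = (\<lambda>n. \<zero>\<^bsub>A\<^esub>)"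
    and add_ps_algebra: "x \<oplus>\<^bsub>ps_algebra A\<^esub> y = (\<lambda>n. x n \<oplus>\<^bsub>A\<^esub> y n)"
    and smult_ps_algebra:
      "f \<odot>\<^bsub>ps_algebra A\<^esub> x = (\<lambda>n. \<Oplus>\<^bsub>A\<^esub>i \<in> {..n}. f i \<odot>\<^bsub>A\<^esub> x (n - i))"
  by (simp_all add: ps_algebra_def)

lemma (in module) abelian_group_ps_algebra: "abelian_group (ps_algebra M)"
proof (rule abelian_groupI)
  fix x assume x: "x \<in> carrier (ps_algebra M)"
  show "\<exists>y\<in>carrier (ps_algebra M). y \<oplus>\<^bsub>ps_algebra M\<^esub> x = \<zero>\<^bsub>ps_algebra M\<^esub>"
    by (rule bexI[of _ "\<lambda>n. \<ominus>\<^bsub>M\<^esub> x n"])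
      (use x in \<open>auto simp: ps_algebra_sel M.l_neg Pi_iff\<close>)
qed (auto simp: ps_algebra_sel M.a_ac Pi_iff)

text \<open>Both the deformation condition and the brackets are phrased with subtraction in
  \<open>ps_algebra\<close>, whose additive inverse is a definite description. Uniqueness of
  inverses in the abelian group of series identifies it with the coefficientwise negative.\<close>

lemma (in module) minus_ps_algebra:
  assumes "x \<in> UNIV \<rightarrow> carrier M" and "y \<in> UNIV \<rightarrow> carrier M"
  shows "(x \<ominus>\<^bsub>ps_algebra M\<^esub> y) n = x n \<ominus>\<^bsub>M\<^esub> y n"
proof -
  interpret ps: abelian_group "ps_algebra M"
    by (rule abelian_group_ps_algebra)
  have "\<ominus>\<^bsub>ps_algebra M\<^esub> y = (\<lambda>n. \<ominus>\<^bsub>M\<^esub> y n)"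
    by (rule ps.minus_equality) (use assms in \<open>auto simp: ps_algebra_sel M.l_neg Pi_iff\<close>)
  then show ?thesis
    by (simp add: a_minus_def ps_algebra_sel)
qed

lemma (in abelian_monoid) ps_const_closed:
  "a \<in> carrier G \<Longrightarrow> ps_const G a \<in> UNIV \<rightarrow> carrier G"
  by (simp add: ps_const_def)

lemma (in cring) ps_var_closed: "ps_var R \<in> UNIV \<rightarrow> carrier R"
  by (simp add: ps_var_def)

context module
begin

lemma smult_ps_const:
  assumes r: "r \<in> carrier R" and x: "x \<in> UNIV \<rightarrow> carrier M"
  shows "ps_const R r \<odot>\<^bsub>ps_algebra M\<^esub> x = (\<lambda>n. r \<odot>\<^bsub>M\<^esub> x n)"
proof
  fix n
  have "(\<Oplus>\<^bsub>M\<^esub>i \<in> {..n}. ps_const R r i \<odot>\<^bsub>M\<^esub> x (n - i)) =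
        (\<Oplus>\<^bsub>M\<^esub>i \<in> {..n}. if 0 = i then r \<odot>\<^bsub>M\<^esub> x (n - i) else \<zero>\<^bsub>M\<^esub>)"
    by (rule M.finsum_cong') (use r x in \<open>auto simp: ps_const_def Pi_iff\<close>)
  also have "\<dots> = r \<odot>\<^bsub>M\<^esub> x (n - 0)"
    by (rule M.finsum_singleton) (use r x in \<open>auto simp: Pi_iff\<close>)
  finally show "(ps_const R r \<odot>\<^bsub>ps_algebra M\<^esub> x) n = r \<odot>\<^bsub>M\<^esub> x n"
    by (simp add: smult_ps_algebra)
qed

text \<open>Only the summand with index 1 of the Cauchy sum survives, and for \<open>n = 0\<close>
  the range does not contain it. Multiplication by \<nu> is therefore a shift with a zero inserted
  at the front.\<close>

lemma smult_ps_var: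
  assumes x: "x \<in> UNIV \<rightarrow> carrier M"
  shows "(ps_var R \<odot>\<^bsub>ps_algebra M\<^esub> x) n = (case n of 0 \<Rightarrow> \<zero>\<^bsub>M\<^esub> | Suc k \<Rightarrow> x k)"
proof (cases n)
  case 0
  then show ?thesis
    using x by (simp add: smult_ps_algebra ps_var_def Pi_iff)
next
  case (Suc k)
  have "(\<Oplus>\<^bsub>M\<^esub>i \<in> {..n}. ps_var R i \<odot>\<^bsub>M\<^esub> x (n - i)) =
        (\<Oplus>\<^bsub>M\<^esub>i \<in> {..n}. if 1 = i then x (n - i) else \<zero>\<^bsub>M\<^esub>)"
    by (rule M.finsum_cong') (use x in \<open>auto simp: ps_var_def Pi_iff\<close>)
  also have "\<dots> = x (n - 1)"
    by (rule M.finsum_singleton) (use x Suc in \<open>auto simp: Pi_iff\<close>)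
  finally show ?thesis
    by (simp add: smult_ps_algebra Suc)
qed

text \<open>Peeling off one coefficient suffices to reach the orders 0 and 1. It expresses a series
  by a finite sum, to which bilinearity applies directly, without any continuity in \<nu>.\<close>

lemma ps_split:
  assumes "x \<in> UNIV \<rightarrow> carrier M"
  shows "x = ps_const M (x 0) \<oplus>\<^bsub>ps_algebra M\<^esub>
             (ps_var R \<odot>\<^bsub>ps_algebra M\<^esub> (\<lambda>n. x (Suc n)))"
proof
  fix n
  have "(\<lambda>n. x (Suc n)) \<in> UNIV \<rightarrow> carrier M"
    using assms by auto
  then show "x n = (ps_const M (x 0) \<oplus>\<^bsub>ps_algebra M\<^esub>
               (ps_var R \<odot>\<^bsub>ps_algebra M\<^esub> (\<lambda>n. x (Suc n)))) n"
    using assms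
    by (cases n) (auto simp: add_ps_algebra smult_ps_var ps_const_def Pi_iff)
qed

end

section \<open>Derivations and Hochschild cocycles\<close>

context assoc_algebra
begin

lemma commutator_derivation:
  assumes h: "h \<in> carrier A"
  shows "is_derivation R A (commutator A h)"
  unfolding is_derivation_def
proof (intro conjI ballI funcsetI)
  fix a b assume ab: "a \<in> carrier A" "b \<in> carrier A"
  show "commutator A h (a \<oplus>\<^bsub>A\<^esub> b) = commutator A h a \<oplus>\<^bsub>A\<^esub> commutator A h b"
    unfolding commutator_def using h ab by algebra
  show "commutator A h (a \<otimes>\<^bsub>A\<^esub> b) =
        a \<otimes>\<^bsub>A\<^esub> commutator A h b \<oplus>\<^bsub>A\<^esub> commutator A h a \<otimes>\<^bsub>A\<^esub> b"
    unfolding commutator_def using h ab by algebra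
next
  fix r a assume "r \<in> carrier R" "a \<in> carrier A"
  then show "commutator A h (r \<odot>\<^bsub>A\<^esub> a) = r \<odot>\<^bsub>A\<^esub> commutator A h a"
    using h by (simp add: commutator_def a_minus_def smult_mult_left smult_mult_right
        smult_r_distr smult_r_minus)
qed (use h in \<open>simp add: commutator_def\<close>)

lemma is_derivation_add:
  assumes D: "is_derivation R A D" and E: "is_derivation R A E"
  shows "is_derivation R A (\<lambda>a. D a \<oplus>\<^bsub>A\<^esub> E a)"
proof -
  have cl: "D a \<in> carrier A" "E a \<in> carrier A" if "a \<in> carrier A" for a
    using D E that by (auto simp: is_derivation_def)
  show ?thesis
    using D E unfolding is_derivation_def
    by (auto simp: cl smult_r_distr r_distr l_distr a_ac)
qed

text \<open>The last clause is the vanishing of the Hochschild coboundary with the negative terms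
  moved across. In this shape it is what the coefficient of \<nu> in the associativity of a deformed
  product yields.\<close>

definition hochschild_cocycle :: "('c \<Rightarrow> 'c \<Rightarrow> 'c) \<Rightarrow> bool" where
  "hochschild_cocycle m \<longleftrightarrow>
     (\<forall>a \<in> carrier A. \<forall>b \<in> carrier A. m a b \<in> carrier A) \<and>
     (\<forall>a \<in> carrier A. \<forall>b \<in> carrier A. \<forall>c \<in> carrier A.
        m (a \<oplus>\<^bsub>A\<^esub> b) c = m a c \<oplus>\<^bsub>A\<^esub> m b c \<and> m c (a \<oplus>\<^bsub>A\<^esub> b) = m c a \<oplus>\<^bsub>A\<^esub> m c b) \<and>
     (\<forall>r \<in> carrier R. \<forall>a \<in> carrier A. \<forall>b \<in> carrier A.
        m (r \<odot>\<^bsub>A\<^esub> a) b = r \<odot>\<^bsub>A\<^esub> m a b \<and> m a (r \<odot>\<^bsub>A\<^esub> b) = r \<odot>\<^bsub>A\<^esub> m a b) \<and>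
     (\<forall>a \<in> carrier A. \<forall>b \<in> carrier A. \<forall>c \<in> carrier A.
        m (a \<otimes>\<^bsub>A\<^esub> b) c \<oplus>\<^bsub>A\<^esub> m a b \<otimes>\<^bsub>A\<^esub> c = m a (b \<otimes>\<^bsub>A\<^esub> c) \<oplus>\<^bsub>A\<^esub> a \<otimes>\<^bsub>A\<^esub> m b c)"

lemma cocycle_derivation:
  assumes m: "hochschild_cocycle m" and h: "h \<in> center A"
  shows "is_derivation R A (\<lambda>a. m h a \<ominus>\<^bsub>A\<^esub> m a h)"
proof -
  have hc: "h \<in> carrier A" and comm: "\<And>a. a \<in> carrier A \<Longrightarrow> h \<otimes>\<^bsub>A\<^esub> a = a \<otimes>\<^bsub>A\<^esub> h"
    using h by (auto simp: center_def)
  have cl: "m a b \<in> carrier A" if "a \<in> carrier A" "b \<in> carrier A" for a b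
    using m that by (simp add: hochschild_cocycle_def)
  have cocycle: "m (a \<otimes>\<^bsub>A\<^esub> b) c \<oplus>\<^bsub>A\<^esub> m a b \<otimes>\<^bsub>A\<^esub> c = m a (b \<otimes>\<^bsub>A\<^esub> c) \<oplus>\<^bsub>A\<^esub> a \<otimes>\<^bsub>A\<^esub> m b c"
    if "a \<in> carrier A" "b \<in> carrier A" "c \<in> carrier A" for a b c
    using m that by (simp add: hochschild_cocycle_def)
  \<comment> \<open>This isolates one term of a cocycle identity, so that the three instances below
    can be substituted into the Leibniz rule.\<close>
  have solve: "x = p \<oplus>\<^bsub>A\<^esub> u \<ominus>\<^bsub>A\<^esub> s"
    if "p \<oplus>\<^bsub>A\<^esub> u = x \<oplus>\<^bsub>A\<^esub> s" "x \<in> carrier A" "s \<in> carrier A" for x p u s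
    unfolding that(1) using that(2,3) by algebra
  show ?thesis
    unfolding is_derivation_def
  proof (intro conjI ballI funcsetI)
    fix a b assume a: "a \<in> carrier A" and b: "b \<in> carrier A"
    have add: "m h (a \<oplus>\<^bsub>A\<^esub> b) = m h a \<oplus>\<^bsub>A\<^esub> m h b" "m (a \<oplus>\<^bsub>A\<^esub> b) h = m a h \<oplus>\<^bsub>A\<^esub> m b h"
      using m a b hc by (auto simp: hochschild_cocycle_def)
    show "m h (a \<oplus>\<^bsub>A\<^esub> b) \<ominus>\<^bsub>A\<^esub> m (a \<oplus>\<^bsub>A\<^esub> b) h =
          (m h a \<ominus>\<^bsub>A\<^esub> m a h) \<oplus>\<^bsub>A\<^esub> (m h b \<ominus>\<^bsub>A\<^esub> m b h)"
      unfolding add using cl[OF hc a] cl[OF a hc] cl[OF hc b] cl[OF b hc] by algebra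
    \<comment> \<open>Each of \<open>p\<close>, \<open>q\<close>, \<open>s\<close> occurs in two of
      the three cocycle identities once \<open>h\<close> is commuted past \<open>a\<close>,
      \<open>b\<close> and \<open>m a b\<close> respectively, and these are the terms to be
      eliminated. The terms \<open>u\<close>, \<open>v\<close>, \<open>w\<close>, \<open>t\<close>
      are the ones that remain in the Leibniz rule.\<close>
    define p q s where "p = m (h \<otimes>\<^bsub>A\<^esub> a) b" and "q = m a (h \<otimes>\<^bsub>A\<^esub> b)" and "s = h \<otimes>\<^bsub>A\<^esub> m a b"
    define u v w t where "u = m h a \<otimes>\<^bsub>A\<^esub> b" and "v = m a h \<otimes>\<^bsub>A\<^esub> b"
      and "w = a \<otimes>\<^bsub>A\<^esub> m h b" and "t = a \<otimes>\<^bsub>A\<^esub> m b h"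
    note defs = p_def q_def s_def u_def v_def w_def t_def
    have carr: "p \<in> carrier A" "q \<in> carrier A" "s \<in> carrier A" "u \<in> carrier A"
      "v \<in> carrier A" "w \<in> carrier A" "t \<in> carrier A"
      using a b hc by (simp_all add: defs cl)
    have mab: "m h (a \<otimes>\<^bsub>A\<^esub> b) \<in> carrier A" "m (a \<otimes>\<^bsub>A\<^esub> b) h \<in> carrier A"
      using a b hc by (simp_all add: cl)
    have 1: "m h (a \<otimes>\<^bsub>A\<^esub> b) = p \<oplus>\<^bsub>A\<^esub> u \<ominus>\<^bsub>A\<^esub> s"
      by (rule solve) (use cocycle[OF hc a b] carr mab in \<open>simp_all add: defs\<close>)
    have 2: "w = p \<oplus>\<^bsub>A\<^esub> v \<ominus>\<^bsub>A\<^esub> q"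
    proof (rule solve)
      show "p \<oplus>\<^bsub>A\<^esub> v = w \<oplus>\<^bsub>A\<^esub> q"
        using cocycle[OF a hc b] a_comm[OF carr(2,6)] by (simp add: defs comm[OF a])
    qed (use carr in auto)
    have 3: "m (a \<otimes>\<^bsub>A\<^esub> b) h = q \<oplus>\<^bsub>A\<^esub> t \<ominus>\<^bsub>A\<^esub> s"
      by (rule solve) (use cocycle[OF a b hc] carr mab in
          \<open>simp_all add: defs comm[OF b] comm[OF cl[OF a b]]\<close>)
    \<comment> \<open>In the difference of \<open>1\<close> and \<open>3\<close> the two copies of
      \<open>s\<close> cancel, and \<open>2\<close> removes \<open>p\<close> and
      \<open>q\<close>.\<close>
    have "m h (a \<otimes>\<^bsub>A\<^esub> b) \<ominus>\<^bsub>A\<^esub> m (a \<otimes>\<^bsub>A\<^esub> b) h = (w \<ominus>\<^bsub>A\<^esub> t) \<oplus>\<^bsub>A\<^esub> (u \<ominus>\<^bsub>A\<^esub> v)"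
      unfolding 1 2 3 using carr by algebra
    also have "\<dots> = a \<otimes>\<^bsub>A\<^esub> (m h b \<ominus>\<^bsub>A\<^esub> m b h) \<oplus>\<^bsub>A\<^esub> (m h a \<ominus>\<^bsub>A\<^esub> m a h) \<otimes>\<^bsub>A\<^esub> b"
      unfolding u_def v_def w_def t_def
      using a b cl[OF hc a] cl[OF a hc] cl[OF hc b] cl[OF b hc] by algebra
    finally show "m h (a \<otimes>\<^bsub>A\<^esub> b) \<ominus>\<^bsub>A\<^esub> m (a \<otimes>\<^bsub>A\<^esub> b) h =
      a \<otimes>\<^bsub>A\<^esub> (m h b \<ominus>\<^bsub>A\<^esub> m b h) \<oplus>\<^bsub>A\<^esub> (m h a \<ominus>\<^bsub>A\<^esub> m a h) \<otimes>\<^bsub>A\<^esub> b" .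
  next
    fix r a assume "r \<in> carrier R" "a \<in> carrier A"
    then show "m h (r \<odot>\<^bsub>A\<^esub> a) \<ominus>\<^bsub>A\<^esub> m (r \<odot>\<^bsub>A\<^esub> a) h = r \<odot>\<^bsub>A\<^esub> (m h a \<ominus>\<^bsub>A\<^esub> m a h)"
      using m hc cl
      by (simp add: hochschild_cocycle_def a_minus_def smult_r_distr smult_r_minus)
  qed (use hc cl in simp)
qed

end

section \<open>The deformed product up to first order in \<nu>\<close>

locale deformed_algebra = assoc_algebra R A
  for R :: "('r, 'm) ring_scheme" (structure) and A :: "('r, 'a, 'n) module_scheme" (structure) +
  fixes star :: "(nat \<Rightarrow> 'a) \<Rightarrow> (nat \<Rightarrow> 'a) \<Rightarrow> (nat \<Rightarrow> 'a)" (infixl "\<star>" 70)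
  assumes deformation: "formal_deformation R A star"
begin

abbreviation "PS \<equiv> UNIV \<rightarrow> carrier A"

abbreviation "const \<equiv> ps_const A"

abbreviation "shift x \<equiv> ps_var R \<odot>\<^bsub>ps_algebra A\<^esub> x"

text \<open>The record update changes only product and unit, so the algebra laws translate into laws
  for \<open>star\<close> over the operations of \<open>ps_algebra A\<close>. None of them mentions
  the existentially quantified unit \<open>e\<close>, which can thus be discharged here.\<close>

lemma star_laws:
  shows star_closed: "\<lbrakk>x \<in> PS; y \<in> PS\<rbrakk> \<Longrightarrow> x \<star> y \<in> PS"
    and star_assoc: "\<lbrakk>x \<in> PS; y \<in> PS; z \<in> PS\<rbrakk> \<Longrightarrow> x \<star> y \<star> z = x \<star> (y \<star> z)"
    and star_add_left: "\<lbrakk>x \<in> PS; y \<in> PS; z \<in> PS\<rbrakk> \<Longrightarrow>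
      (x \<oplus>\<^bsub>ps_algebra A\<^esub> y) \<star> z = x \<star> z \<oplus>\<^bsub>ps_algebra A\<^esub> y \<star> z"
    and star_add_right: "\<lbrakk>x \<in> PS; y \<in> PS; z \<in> PS\<rbrakk> \<Longrightarrow>
      z \<star> (x \<oplus>\<^bsub>ps_algebra A\<^esub> y) = z \<star> x \<oplus>\<^bsub>ps_algebra A\<^esub> z \<star> y"
    and star_smult_left: "\<lbrakk>f \<in> UNIV \<rightarrow> carrier R; x \<in> PS; y \<in> PS\<rbrakk> \<Longrightarrow>
      (f \<odot>\<^bsub>ps_algebra A\<^esub> x) \<star> y = f \<odot>\<^bsub>ps_algebra A\<^esub> (x \<star> y)"
    and star_smult_right: "\<lbrakk>f \<in> UNIV \<rightarrow> carrier R; x \<in> PS; y \<in> PS\<rbrakk> \<Longrightarrow>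
      x \<star> (f \<odot>\<^bsub>ps_algebra A\<^esub> y) = f \<odot>\<^bsub>ps_algebra A\<^esub> (x \<star> y)"
    and smult_ps_closed: "\<lbrakk>f \<in> UNIV \<rightarrow> carrier R; x \<in> PS\<rbrakk> \<Longrightarrow>
      f \<odot>\<^bsub>ps_algebra A\<^esub> x \<in> PS"
proof -
  obtain e where "assoc_algebra (ps_ring R) ((ps_algebra A)\<lparr>mult := star, one := e\<rparr>)"
    using deformation by (auto simp: formal_deformation_def)
  then interpret B: assoc_algebra "ps_ring R" "(ps_algebra A)\<lparr>mult := star, one := e\<rparr>" .
  note [simp] = carrier_ps_algebra carrier_ps_ring
  show "\<lbrakk>x \<in> PS; y \<in> PS\<rbrakk> \<Longrightarrow> x \<star> y \<in> PS"
    using B.m_closed[of x y] by simp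
  show "\<lbrakk>x \<in> PS; y \<in> PS; z \<in> PS\<rbrakk> \<Longrightarrow> x \<star> y \<star> z = x \<star> (y \<star> z)"
    using B.m_assoc[of x y z] by simp
  show "\<lbrakk>x \<in> PS; y \<in> PS; z \<in> PS\<rbrakk> \<Longrightarrow>
      (x \<oplus>\<^bsub>ps_algebra A\<^esub> y) \<star> z = x \<star> z \<oplus>\<^bsub>ps_algebra A\<^esub> y \<star> z"
    using B.l_distr[of x y z] by simp
  show "\<lbrakk>x \<in> PS; y \<in> PS; z \<in> PS\<rbrakk> \<Longrightarrow>
      z \<star> (x \<oplus>\<^bsub>ps_algebra A\<^esub> y) = z \<star> x \<oplus>\<^bsub>ps_algebra A\<^esub> z \<star> y"
    using B.r_distr[of x y z] by simp
  show "\<lbrakk>f \<in> UNIV \<rightarrow> carrier R; x \<in> PS; y \<in> PS\<rbrakk> \<Longrightarrow>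
      (f \<odot>\<^bsub>ps_algebra A\<^esub> x) \<star> y = f \<odot>\<^bsub>ps_algebra A\<^esub> (x \<star> y)"
    using B.smult_mult_left[of f x y] by simp
  show "\<lbrakk>f \<in> UNIV \<rightarrow> carrier R; x \<in> PS; y \<in> PS\<rbrakk> \<Longrightarrow>
      x \<star> (f \<odot>\<^bsub>ps_algebra A\<^esub> y) = f \<odot>\<^bsub>ps_algebra A\<^esub> (x \<star> y)"
    using B.smult_mult_right[of f x y] by simp
  show "\<lbrakk>f \<in> UNIV \<rightarrow> carrier R; x \<in> PS\<rbrakk> \<Longrightarrow> f \<odot>\<^bsub>ps_algebra A\<^esub> x \<in> PS"
    using B.smult_closed[of f x] by simp
qed

lemma star_const_0:
  assumes a: "a \<in> carrier A" and b: "b \<in> carrier A"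
  shows "(const a \<star> const b) 0 = a \<otimes>\<^bsub>A\<^esub> b"
proof -
  have cl: "const a \<star> const b \<in> PS" "const (a \<otimes>\<^bsub>A\<^esub> b) \<in> PS"
    using a b by (simp_all add: star_closed ps_const_closed del: Pi_UNIV)
  obtain x where x: "x \<in> PS"
    "const a \<star> const b \<ominus>\<^bsub>ps_algebra A\<^esub> const (a \<otimes>\<^bsub>A\<^esub> b) = shift x"
    using deformation a b unfolding formal_deformation_def carrier_ps_algebra by blast
  \<comment> \<open>A multiple of \<nu> has no coefficient of order 0.\<close>
  have "(const a \<star> const b) 0 \<ominus>\<^bsub>A\<^esub> const (a \<otimes>\<^bsub>A\<^esub> b) 0 = \<zero>\<^bsub>A\<^esub>"
    unfolding minus_ps_algebra[OF cl, symmetric] x(2) by (simp add: smult_ps_var[OF x(1)])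
  then have diff: "(const a \<star> const b) 0 \<ominus>\<^bsub>A\<^esub> a \<otimes>\<^bsub>A\<^esub> b = \<zero>\<^bsub>A\<^esub>"
    by (simp add: ps_const_def[of A "a \<otimes>\<^bsub>A\<^esub> b"])
  have c: "(const a \<star> const b) 0 \<in> carrier A"
    using cl(1) by auto
  have "(const a \<star> const b) 0 =
        ((const a \<star> const b) 0 \<ominus>\<^bsub>A\<^esub> a \<otimes>\<^bsub>A\<^esub> b) \<oplus>\<^bsub>A\<^esub> a \<otimes>\<^bsub>A\<^esub> b"
    using a b c by algebra
  also have "\<dots> = a \<otimes>\<^bsub>A\<^esub> b"
    unfolding diff using a b by simp
  finally show ?thesis .
qed

text \<open>By linearity over power series the factor \<nu> leaves the product, so the coefficient
  of order n + 1 of the second summand is a coefficient of order n of another deformed product. This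
  gives the step from \<open>star_0\<close> to \<open>star_1\<close>.\<close>

lemma star_split_left:
  assumes x: "x \<in> PS" and y: "y \<in> PS"
  shows "x \<star> y = const (x 0) \<star> y \<oplus>\<^bsub>ps_algebra A\<^esub> shift ((\<lambda>n. x (Suc n)) \<star> y)"
proof -
  have cl: "const (x 0) \<in> PS" "(\<lambda>n. x (Suc n)) \<in> PS"
    using x by (auto intro!: ps_const_closed)
  show ?thesis
    by (subst ps_split[OF x])
      (simp only: star_add_left[OF cl(1) smult_ps_closed[OF ps_var_closed cl(2)] y]
        star_smult_left[OF ps_var_closed cl(2) y])
qed

lemma star_split_right:
  assumes x: "x \<in> PS" and y: "y \<in> PS"
  shows "x \<star> y = x \<star> const (y 0) \<oplus>\<^bsub>ps_algebra A\<^esub> shift (x \<star> (\<lambda>n. y (Suc n)))"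
proof -
  have cl: "const (y 0) \<in> PS" "(\<lambda>n. y (Suc n)) \<in> PS"
    using y by (auto intro!: ps_const_closed)
  show ?thesis
    by (subst ps_split[OF y])
      (simp only: star_add_right[OF cl(1) smult_ps_closed[OF ps_var_closed cl(2)] x]
        star_smult_right[OF ps_var_closed x cl(2)])
qed

lemma star_0:
  assumes x: "x \<in> PS" and y: "y \<in> PS"
  shows "(x \<star> y) 0 = x 0 \<otimes>\<^bsub>A\<^esub> y 0"
proof -
  have c: "x 0 \<in> carrier A" "y 0 \<in> carrier A"
    using x y by auto
  have cl: "const (x 0) \<in> PS" "const (y 0) \<in> PS" "(\<lambda>n. x (Suc n)) \<in> PS" "(\<lambda>n. y (Suc n)) \<in> PS"
    using x y by (auto intro!: ps_const_closed)
  show ?thesis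
    \<comment> \<open>After splitting both factors, the two shifted remainders vanish at order 0 and
      only the product of constants is left.\<close>
    unfolding star_split_left[OF x y] star_split_right[OF cl(1) y]
    using c cl y
    by (simp add: add_ps_algebra smult_ps_var star_closed star_const_0 del: Pi_UNIV)
qed

lemma star_1:
  assumes x: "x \<in> PS" and y: "y \<in> PS"
  shows "(x \<star> y) 1 =
    (const (x 0) \<star> const (y 0)) 1 \<oplus>\<^bsub>A\<^esub> x 0 \<otimes>\<^bsub>A\<^esub> y 1 \<oplus>\<^bsub>A\<^esub> x 1 \<otimes>\<^bsub>A\<^esub> y 0"
proof -
  have cl: "const (x 0) \<in> PS" "const (y 0) \<in> PS" "(\<lambda>n. x (Suc n)) \<in> PS" "(\<lambda>n. y (Suc n)) \<in> PS"
    using x y by (auto intro!: ps_const_closed)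
  have c0: "const (x 0) 0 = x 0"
    by (simp add: ps_const_def)
  show ?thesis
    \<comment> \<open>At order 1 the shifted remainders contribute their coefficients of order 0.
      These are given by \<open>star_0\<close>, where the tails of \<open>x\<close> and
      \<open>y\<close> start with \<open>x 1\<close> and \<open>y 1\<close>.\<close>
    unfolding star_split_left[OF x y] star_split_right[OF cl(1) y]
    using cl y
    by (simp add: add_ps_algebra smult_ps_var star_closed star_0 c0 del: Pi_UNIV)
qed

text \<open>Linearity is inherited from \<open>star\<close> because forming constant series is
  itself linear. The cocycle identity comes from comparing the coefficients of \<nu> on both sides
  of associativity.\<close>

lemma hochschild_cocycle_star: "hochschild_cocycle (\<lambda>a b. (const a \<star> const b) 1)"
proof -
  note cc = ps_const_closed
  have cl: "(const a \<star> const b) n \<in> carrier A" if "a \<in> carrier A" "b \<in> carrier A" for a b n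
    using star_closed[OF cc[OF that(1)] cc[OF that(2)]] by auto
  have c01: "const a 0 = a" "const a 1 = \<zero>\<^bsub>A\<^esub>" for a
    by (simp_all add: ps_const_def)
  have add: "const (a \<oplus>\<^bsub>A\<^esub> b) = const a \<oplus>\<^bsub>ps_algebra A\<^esub> const b"
    if "a \<in> carrier A" "b \<in> carrier A" for a b
    using that by (auto simp: ps_const_def add_ps_algebra)
  \<comment> \<open>Homogeneity of \<open>star\<close> is available for scalars that are power
    series, so \<open>r\<close> is turned into a constant one.\<close>
  have smult: "const (r \<odot>\<^bsub>A\<^esub> a) = ps_const R r \<odot>\<^bsub>ps_algebra A\<^esub> const a"
    if "r \<in> carrier R" "a \<in> carrier A" for r a
    unfolding smult_ps_const[OF that(1) cc[OF that(2)]] using that by (auto simp: ps_const_def)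
  show ?thesis
    unfolding hochschild_cocycle_def
  proof (intro conjI ballI)
    fix a b c assume a: "a \<in> carrier A" and b: "b \<in> carrier A" and c: "c \<in> carrier A"
    show "(const (a \<oplus>\<^bsub>A\<^esub> b) \<star> const c) 1 = (const a \<star> const c) 1 \<oplus>\<^bsub>A\<^esub> (const b \<star> const c) 1"
      unfolding add[OF a b] star_add_left[OF cc[OF a] cc[OF b] cc[OF c]] by (simp add: add_ps_algebra)
    show "(const c \<star> const (a \<oplus>\<^bsub>A\<^esub> b)) 1 = (const c \<star> const a) 1 \<oplus>\<^bsub>A\<^esub> (const c \<star> const b) 1"
      unfolding add[OF a b] star_add_right[OF cc[OF a] cc[OF b] cc[OF c]] by (simp add: add_ps_algebra)
    have ab: "const a \<star> const b \<in> PS" and bc: "const b \<star> const c \<in> PS"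
      using a b c by (simp_all add: star_closed cc del: Pi_UNIV)
    have "(const a \<star> const b \<star> const c) 1 = (const a \<star> (const b \<star> const c)) 1"
      by (simp only: star_assoc[OF cc[OF a] cc[OF b] cc[OF c]])
    then show "(const (a \<otimes>\<^bsub>A\<^esub> b) \<star> const c) 1 \<oplus>\<^bsub>A\<^esub> (const a \<star> const b) 1 \<otimes>\<^bsub>A\<^esub> c =
               (const a \<star> const (b \<otimes>\<^bsub>A\<^esub> c)) 1 \<oplus>\<^bsub>A\<^esub> a \<otimes>\<^bsub>A\<^esub> (const b \<star> const c) 1"
      \<comment> \<open>In each expansion by \<open>star_1\<close> one factor is a constant series,
        whose coefficient of order 1 is zero. So one of the three terms drops out on either
        side.\<close>
      unfolding star_1[OF ab cc[OF c]] star_1[OF cc[OF a] bc]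
        star_const_0[OF a b] star_const_0[OF b c] c01
      using a b c cl[OF a b, of 1] cl[OF b c, of 1]
        cl[of "a \<otimes>\<^bsub>A\<^esub> b" c 1] cl[of a "b \<otimes>\<^bsub>A\<^esub> c" 1]
      by simp
  next
    fix r a b assume r: "r \<in> carrier R" and a: "a \<in> carrier A" and b: "b \<in> carrier A"
    note r' = R.ps_const_closed[OF r]
    note ab = star_closed[OF cc[OF a] cc[OF b]]
    show "(const (r \<odot>\<^bsub>A\<^esub> a) \<star> const b) 1 = r \<odot>\<^bsub>A\<^esub> (const a \<star> const b) 1"
      by (simp add: smult[OF r a] star_smult_left[OF r' cc[OF a] cc[OF b]] smult_ps_const[OF r ab])
    show "(const a \<star> const (r \<odot>\<^bsub>A\<^esub> b)) 1 = r \<odot>\<^bsub>A\<^esub> (const a \<star> const b) 1"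
      by (simp add: smult[OF r b] star_smult_right[OF r' cc[OF a] cc[OF b]] smult_ps_const[OF r ab])
  qed (rule cl)
qed

lemma deformation_bracket_derivation:
  assumes h: "h \<in> center A"
  shows "is_derivation R A (deformation_bracket A star 1 h)"
proof -
  have hc: "h \<in> carrier A"
    using h by (simp add: center_def)
  have "deformation_bracket A star 1 h a = (const h \<star> const a) 1 \<ominus>\<^bsub>A\<^esub> (const a \<star> const h) 1"
    if "a \<in> carrier A" for a
    unfolding deformation_bracket_def
    using hc that by (intro minus_ps_algebra star_closed ps_const_closed)
  \<comment> \<open>The equality of the two maps holds on \<open>carrier A\<close>, and
    \<open>is_derivation\<close> evaluates a map only at elements of the carrier.\<close>
  then show ?thesis
    using cocycle_derivation[OF hochschild_cocycle_star h]
    by (simp add: is_derivation_def Pi_iff)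
qed

end

theorem proposition2p19:
  fixes R :: "('r, 'm) ring_scheme"
    and A :: "('r, 'a, 'n) module_scheme"
    and star :: "(nat \<Rightarrow> 'a) \<Rightarrow> (nat \<Rightarrow> 'a) \<Rightarrow> (nat \<Rightarrow> 'a)"
    and H :: "'a \<times> 'a set"
  assumes "cring R"
    and "assoc_algebra R A"
    and "formal_deformation R A star"
    and "H \<in> Pi_space A"
  shows "is_derivation R A (\<lambda>a. Pi_bracket A star H a)"
proof -
  interpret deformed_algebra R A star
    using assms by (simp add: deformed_algebra_def deformed_algebra_axioms_def)
  \<comment> \<open>A fixed representative \<open>h\<close> of the coset is chosen here;
    \<open>Pi_bracket_rep\<close> puts it in place of the one selected by \<open>SOME\<close>, which
    splits the bracket into the cocycle part and an inner derivation.\<close>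
  obtain H0 h where H: "H = (H0, center A +>\<^bsub>A\<^esub> h)" "H0 \<in> center A" "h \<in> carrier A"
    using assms(4) by (auto simp: Pi_space_def A_RCOSETS_def')
  have "Pi_bracket A star H a = deformation_bracket A star 1 H0 a \<oplus>\<^bsub>A\<^esub> commutator A h a"
    if "a \<in> carrier A" for a
    unfolding H(1) by (rule Pi_bracket_rep) (use H that ring_axioms in auto)
  then show ?thesis
    using is_derivation_add[OF deformation_bracket_derivation[OF H(2)] commutator_derivation[OF H(3)]]
    by (simp add: is_derivation_def Pi_iff)
qed

end
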